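(* Let $w_1,w_2\in\mathbb{Z}_{\geq 0}$ be not both zero, let $d=\gcd(w_1,w_2)$, and let $\Phi_{w_1,w_2}\subseteq\mathbb{Z}_{\geq 0}$ be the section of the discrete diagram defined in the context. (1) (Gap) Let $\alpha=\min\left\{d,\frac{w_1}{d},\frac{w_2}{d}\right\}$. Then $\{1,\dots,\alpha-1\}\subseteq\mathbb{Z}_{\geq 0}\setminus\Phi_{w_1,w_2}$. (2) (Semigroup) Let $S_{w_1,w_2}=\left\{m_1\frac{w_1}{d}+m_2\frac{w_2}{d}\,:\,m_1,m_2\in\mathbb{Z}_{\geq 0}\right\}$. Then $S_{w_1,w_2}\subseteq\Phi_{w_1,w_2}$. (3) (Saturation) Let $\beta=\min\{w_1\bmod w_2,\ w_2\bmod w_1\}$. Then $\mathbb{Z}_{\geq\beta}\subseteq\Phi_{w_1,w_2}$.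
   Context: A lattice polytope in $\mathbb{R}^2$ is the convex hull of a nonempty finite subset of $\mathbb{Z}^2$ (points and segments are allowed); $\mathcal{P}(\mathbb{Z}^2)$ denotes the set of all of them. For $P,Q\in\mathcal{P}(\mathbb{Z}^2)$ the normalized mixed area is $V(P,Q)=\frac12\left(\mathrm{Vol}_2(P+Q)-\mathrm{Vol}_2(P)-\mathrm{Vol}_2(Q)\right)$, where $P+Q$ is the Minkowski sum and $\mathrm{Vol}_2$ is twice the Euclidean area; it is a non-negative integer. A vector $u\in\mathbb{Z}^2$ is primitive if its coordinates are relatively prime. The lattice width of $P$ in the direction of a primitive $u$ is $\mathrm{w}_u(P)=\max_{x\in P}\langle x,u\rangle-\min_{x\in P}\langle x,u\rangle$, where $\langle\cdot,\cdot\rangle$ is the standard inner product. Fix a primitive vector $u\in\mathbb{Z}^2$. The discrete diagram is $\Phi=\{(\mathrm{w}_u(P),V(P,Q),\mathrm{w}_u(Q)) : P,Q\in\mathcal{P}(\mathbb{Z}^2)\}\subseteq\mathbb{Z}^3$; it does not depend on the choice of $u$. For $(w_1,w_2)\in\mathbb{Z}_{\geq 0}^2$ put $\Phi_{w_1,w_2}=\{v\in\mathbb{Z}_{\geq 0} : (w_1,v,w_2)\in\Phi\}$. The notation $m\bmod n$ means the remainder when $m$ is divided by $n$, and $\mathbb{Z}_{\ge\beta}$ is the set of integers that are at least $\beta$.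
   Formalization: Parts (2) and (3) are stated only when both widths are positive or the pair is (1,0) or (0,1): if one width is 0 and the other is w ≥ 2, then Φ consists of the multiples of w, while S is all of Z≥0 and β is 0 (reading w mod 0 as any non-negative value), so both parts fail. *)

theory Defs
  imports "HOL-Analysis.Analysis" "HOL-Library.Set_Algebras"
begin

definition integer_lattice :: "(real^2) set" where
  "integer_lattice = {x. \<forall>i. x $ i \<in> \<int>}"

definition lattice_polytope :: "(real^2) set \<Rightarrow> bool" where
  "lattice_polytope P \<longleftrightarrow>
     (\<exists>V. finite V \<and> V \<noteq> {} \<and> V \<subseteq> integer_lattice \<and> P = convex hull V)"

definition primitive_vector :: "real^2 \<Rightarrow> bool" where
  "primitive_vector u \<longleftrightarrow>
     (\<exists>a b :: int. coprime a b \<and> u = vector [of_int a, of_int b])"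

definition Vol2 :: "(real^2) set \<Rightarrow> real" where
  "Vol2 P = 2 * measure lborel P"

text \<open>The sum of the two sets below is the Minkowski sum of \<open>HOL-Library.Set_Algebras\<close>.\<close>

definition mixed_area :: "(real^2) set \<Rightarrow> (real^2) set \<Rightarrow> real" where
  "mixed_area P Q = (Vol2 (P + Q) - Vol2 P - Vol2 Q) / 2"

text \<open>On a nonempty compact set, in particular on a lattice polytope, the supremum and the infimum
  below are attained, so they are the maximum and the minimum.\<close>

definition lattice_width :: "real^2 \<Rightarrow> (real^2) set \<Rightarrow> real" where
  "lattice_width u P = (SUP x\<in>P. x \<bullet> u) - (INF x\<in>P. x \<bullet> u)"

text \<open>The entries of the triples in the diagram are integers, but they are kept as reals, which is
  the type of widths and mixed areas; the section at a pair of widths is a set of naturals.\<close>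

definition discrete_diagram :: "real^2 \<Rightarrow> (real \<times> real \<times> real) set" where
  "discrete_diagram u =
     {(lattice_width u P, mixed_area P Q, lattice_width u Q) | P Q.
        lattice_polytope P \<and> lattice_polytope Q}"

definition diagram_section :: "real^2 \<Rightarrow> nat \<Rightarrow> nat \<Rightarrow> nat set" where
  "diagram_section u w1 w2 = {v. (real w1, real v, real w2) \<in> discrete_diagram u}"

text \<open>Both quotients are exact, the divisor being the greatest common divisor.\<close>

definition width_semigroup :: "nat \<Rightarrow> nat \<Rightarrow> nat set" where
  "width_semigroup w1 w2 =
     {m1 * (w1 div gcd w1 w2) + m2 * (w2 div gcd w1 w2) | m1 m2. True}"

end

theory Submission
  imports Defs
begin

text \<open>Everything rests on one planar estimate. Let \<open>j0\<close> and \<open>j1\<close> be points of \<open>Q\<close> of minimal and maximal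
  \<open>u\<close>-value and \<open>p\<close>, \<open>q\<close> points of \<open>P\<close>. Cut \<open>P\<close> along the segment from \<open>q\<close> to \<open>p\<close>, prolonged in
  direction orthogonal to \<open>u\<close>; shift the left part by \<open>j0\<close>, the right part by \<open>j1\<close>, and
  fill the gap with the part of \<open>Q\<close> above \<open>[j0, j1]\<close> placed at \<open>p\<close>, the part below placed at \<open>q\<close> and the
  parallelogram spanned by \<open>p - q\<close> and \<open>j1 - j0\<close>. Hence \<open>V(P, Q) \<ge> det (j1 - j0, p - q)\<close>, with equality
  for the best \<open>p\<close>, \<open>q\<close> if \<open>Q\<close> is a segment.

  Gap: let \<open>I\<close>, \<open>J\<close> join lattice points of extremal \<open>u\<close>-value in \<open>P\<close>, \<open>Q\<close>. The number \<open>det (J, I)\<close> is a multiple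
  of \<open>d\<close>. If it vanishes, then \<open>det (J, \<cdot>)\<close> takes multiples of \<open>w2 / d\<close> on lattice vectors and \<open>det (I, \<cdot>)\<close>
  multiples of \<open>w1 / d\<close>, so a smaller mixed area forces \<open>P\<close> and \<open>Q\<close> into parallel lines and is \<open>0\<close>.

  Semigroup: take triangles on opposite sides of parallel segments \<open>I\<close>, \<open>J\<close> in direction \<open>(d, 1)\<close>; then
  \<open>P + Q = (P + J) \<union> (I + Q)\<close>.
  Saturation: if \<open>w1 \<ge> w2 > 0\<close>, take \<open>Q = [0, (w2, 1)]\<close> and for \<open>P\<close> a triangle with vertices \<open>0\<close>,
  \<open>(w1, w1 div w2)\<close> and a third point at which \<open>det ((w2, 1), \<cdot>)\<close> has the required value.\<close>

subsection \<open>Minkowski sums in the plane\<close>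

definition det2 :: "real^2 \<Rightarrow> real^2 \<Rightarrow> real" where
  "det2 a b = a $ 1 * b $ 2 - a $ 2 * b $ 1"

lemma det2_simps:
  "det2 a (b + c) = det2 a b + det2 a c" "det2 a (b - c) = det2 a b - det2 a c"
  "det2 (a + b) c = det2 a c + det2 b c" "det2 (a - b) c = det2 a c - det2 b c"
  "det2 a (r *\<^sub>R b) = r * det2 a b" "det2 (r *\<^sub>R a) b = r * det2 a b"
  "det2 a a = 0" "det2 a 0 = 0" "det2 0 a = 0" "det2 a (- b) = - det2 a b"
  by (simp_all add: det2_def algebra_simps)

lemma det2_swap: "det2 a b = - det2 b a"
  by (simp add: det2_def)

lemma det2_eq_inner: "det2 a b = vector [- (a $ 2), a $ 1] \<bullet> b"
  by (simp add: det2_def inner_vec_def sum_2)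

lemma det2_eq_0_imp_parallel:
  assumes "det2 a b = 0" "a \<noteq> 0"
  obtains t where "b = t *\<^sub>R a"
proof -
  have "a $ 1 \<noteq> 0 \<or> a $ 2 \<noteq> 0"
    using assms(2) by (auto simp: vec_eq_iff forall_2)
  then show ?thesis
  proof
    assume "a $ 1 \<noteq> 0"
    then have "b = (b $ 1 / a $ 1) *\<^sub>R a"
      using assms(1) by (simp add: vec_eq_iff forall_2 det2_def field_simps)
    then show ?thesis by (rule that)
  next
    assume "a $ 2 \<noteq> 0"
    then have "b = (b $ 2 / a $ 2) *\<^sub>R a"
      using assms(1) by (simp add: vec_eq_iff forall_2 det2_def field_simps)
    then show ?thesis by (rule that)
  qed
qed

lemma negligible_det2_line:
  assumes "a \<noteq> 0"
  shows "negligible {z. det2 a z = c}"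
proof -
  have "vector [- (a $ 2), a $ 1] \<noteq> (0 :: real^2)"
    using assms by (auto simp: vec_eq_iff forall_2)
  then show ?thesis
    unfolding det2_eq_inner by (intro negligible_hyperplane) auto
qed

lemma continuous_on_det2 [continuous_intros]:
  "continuous_on S f \<Longrightarrow> continuous_on S (\<lambda>x. det2 a (f x))"
  unfolding det2_eq_inner by (intro continuous_intros)

lemma measure_lebesgue_Un_disjoint:
  assumes "S \<in> lmeasurable" "T \<in> lmeasurable" "S \<inter> T = {}"
  shows "measure lebesgue (S \<union> T) = measure lebesgue S + measure lebesgue T"
  using assms by (simp add: measure_Un3)

lemma lmeasurable_compact_Int_Diff_open:
  fixes P R :: "'a :: euclidean_space set"
  assumes "compact P" "open R"
  shows "P \<inter> R \<in> lmeasurable" "P - R \<in> lmeasurable"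
  using fmeasurable_Int_fmeasurable[OF lmeasurable_compact, of P R] assms
    fmeasurable_Diff[OF lmeasurable_compact, of P R] by auto

lemma parallelogram_image:
  fixes a b :: "real^2"
  defines "f \<equiv> (\<lambda>v :: real^2. (v $ 1) *\<^sub>R a + (v $ 2) *\<^sub>R b)"
  shows "f ` box 0 1 \<in> lmeasurable" "measure lebesgue (f ` box 0 1) = \<bar>det2 a b\<bar>"
    and "f ` cbox 0 1 \<in> lmeasurable" "measure lebesgue (f ` cbox 0 1) = \<bar>det2 a b\<bar>"
proof -
  have lin: "linear f"
    unfolding f_def by (intro linearI) (auto simp: algebra_simps)
  have "det (matrix f) = det2 a b"
    by (simp add: det_2 matrix_def f_def det2_def axis_def)
  moreover have "measure lebesgue (cbox 0 (1 :: real^2)) = 1"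
    by (simp add: content_cbox_cart interval_eq_empty_cart)
  moreover have "measure lebesgue (box 0 (1 :: real^2)) = measure lebesgue (cbox 0 (1 :: real^2))"
    by (simp add: measure_lborel_box_eq measure_lborel_cbox_eq)
  ultimately show "f ` box 0 1 \<in> lmeasurable" "measure lebesgue (f ` box 0 1) = \<bar>det2 a b\<bar>"
     "f ` cbox 0 1 \<in> lmeasurable" "measure lebesgue (f ` cbox 0 1) = \<bar>det2 a b\<bar>"
    using measurable_linear_image[OF lin] measure_linear_image[OF lin] by simp_all
qed

text \<open>The point at the height of \<open>z\<close>, measured by \<open>det2 j\<close>, on the segment from \<open>q\<close> to \<open>p\<close>, clamped to its
  end points. The division is meaningful only if \<open>p\<close> is higher than \<open>q\<close>.\<close>

definition pivot :: "real^2 \<Rightarrow> real^2 \<Rightarrow> real^2 \<Rightarrow> real^2 \<Rightarrow> real^2" where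
  "pivot j p q z = q + max 0 (min 1 ((det2 j z - det2 j q) / (det2 j p - det2 j q))) *\<^sub>R (p - q)"

lemma pivot_on_segment:
  obtains t where "0 \<le> t" "t \<le> 1" "pivot j p q z = q + t *\<^sub>R (p - q)"
proof -
  have "0 \<le> max 0 (min 1 c)" "max 0 (min 1 c) \<le> 1" for c :: real
    by auto
  then show ?thesis
    using that unfolding pivot_def by blast
qed

lemma pivot_in:
  assumes "convex P" "p \<in> P" "q \<in> P"
  shows "pivot j p q z \<in> P"
proof -
  obtain t where t: "0 \<le> t" "t \<le> 1" "pivot j p q z = q + t *\<^sub>R (p - q)"
    by (rule pivot_on_segment)
  have "(1 - t) *\<^sub>R q + t *\<^sub>R p \<in> P"
    using assms t by (intro convexD) auto
  then show ?thesis
    by (simp add: t(3) algebra_simps)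
qed

lemma pivot_add_parallel: "det2 j w = 0 \<Longrightarrow> pivot j p q (z + w) = pivot j p q z"
  by (simp add: pivot_def det2_simps)

lemma pivot_above: "det2 j q < det2 j p \<Longrightarrow> det2 j p \<le> det2 j z \<Longrightarrow> pivot j p q z = p"
  by (simp add: pivot_def field_simps max_def min_def)

lemma pivot_below: "det2 j q < det2 j p \<Longrightarrow> det2 j z \<le> det2 j q \<Longrightarrow> pivot j p q z = q"
  by (simp add: pivot_def max_absorb1 min.coboundedI2 divide_nonpos_pos)

lemma pivot_between:
  assumes "det2 j q < det2 j p" "0 \<le> t" "t \<le> 1" "det2 j w = 0"
  shows "pivot j p q (q + t *\<^sub>R (p - q) + w) = q + t *\<^sub>R (p - q)"
proof -
  have "(det2 j (q + t *\<^sub>R (p - q) + w) - det2 j q) / (det2 j p - det2 j q) = t"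
    using assms by (simp add: det2_simps)
  then show ?thesis
    using assms by (simp add: pivot_def)
qed

lemma det2_pivot:
  assumes "det2 j q < det2 j p" "det2 j q \<le> det2 j z" "det2 j z \<le> det2 j p"
  shows "det2 j (pivot j p q z) = det2 j z"
proof -
  have "max 0 (min 1 ((det2 j z - det2 j q) / (det2 j p - det2 j q)))
      = (det2 j z - det2 j q) / (det2 j p - det2 j q)"
    using assms by (simp add: min_absorb2 max_absorb2)
  then show ?thesis
    using assms by (simp add: pivot_def det2_simps)
qed

lemma open_left_of_pivot: "open {z. z \<bullet> u < pivot j p q z \<bullet> u}"
  unfolding pivot_def divide_inverse by (intro open_Collect_less continuous_intros)

lemma compact_set_plus:
  fixes S T :: "'a :: real_normed_vector set"
  assumes "compact S" "compact T"
  shows "compact (S + T)"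
proof -
  have "S + T = (\<Union>x\<in>S. \<Union>y\<in>T. {x + y})"
    by (auto simp: set_plus_def)
  then show ?thesis
    using compact_sums'[OF assms] by simp
qed

lemma measure_plus_lower_bound:
  fixes P Q :: "(real^2) set"
  assumes P: "compact P" "convex P" and Q: "compact Q" and Qconv: "convex Q"
    and j: "j0 \<in> Q" "j1 \<in> Q" and pq: "p \<in> P" "q \<in> P" and width: "j0 \<bullet> u < j1 \<bullet> u"
    and strip: "\<And>z. z \<in> Q \<Longrightarrow> j0 \<bullet> u \<le> z \<bullet> u \<and> z \<bullet> u \<le> j1 \<bullet> u"
    and less: "det2 (j1 - j0) q < det2 (j1 - j0) p"
  shows "measure lebesgue P + measure lebesgue Q + det2 (j1 - j0) (p - q) \<le> measure lebesgue (P + Q)"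
proof -
  define J where "J = j1 - j0"
  define f where "f = (\<lambda>v :: real^2. (v $ 1) *\<^sub>R (p - q) + (v $ 2) *\<^sub>R J)"
  define R where "R = {z. z \<bullet> u < pivot J p q z \<bullet> u}"
  define U where "U = {z. det2 J j0 < det2 J z} \<inter> {z. z \<bullet> u < j1 \<bullet> u}"
  define D where "D = {z. det2 J z < det2 J j0} \<inter> {z. z \<bullet> u < j1 \<bullet> u}"
  define A1 where "A1 = (+) j0 ` (P \<inter> R)"
  define A2 where "A2 = (+) j1 ` (P - R)"
  define B1 where "B1 = (+) p ` (Q \<inter> U)"
  define B2 where "B2 = (+) q ` (Q \<inter> D)"
  define B3 where "B3 = (+) (j0 + q) ` f ` box 0 1"
  have less': "det2 J q < det2 J p"
    using less by (simp add: J_def)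
  have "J \<noteq> 0"
    using less' by (auto simp: det2_simps)
  have hj: "det2 J j1 = det2 J j0"
    by (simp add: J_def det2_def algebra_simps)
  have xJ: "j1 \<bullet> u = j0 \<bullet> u + J \<bullet> u" "0 < J \<bullet> u"
    using width by (auto simp: J_def inner_simps)
  have "open R" unfolding R_def by (rule open_left_of_pivot)
  have "open U" "open D"
    unfolding U_def D_def by (intro open_Int open_Collect_less continuous_intros)+
  have PR: "P \<inter> R \<in> lmeasurable" "P - R \<in> lmeasurable"
    using lmeasurable_compact_Int_Diff_open[OF P(1) \<open>open R\<close>] by auto
  have QU: "Q \<inter> U \<in> lmeasurable" "Q \<inter> D \<in> lmeasurable"
    using lmeasurable_compact_Int_Diff_open[OF Q] \<open>open U\<close> \<open>open D\<close> by auto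
  have meas: "A1 \<in> lmeasurable" "A2 \<in> lmeasurable" "B1 \<in> lmeasurable" "B2 \<in> lmeasurable"
    "B3 \<in> lmeasurable"
    unfolding A1_def A2_def B1_def B2_def B3_def f_def
    using PR QU parallelogram_image(1) by (auto intro: measurable_translation)

  have A1: "(z - j0) \<bullet> u < pivot J p q (z - j0) \<bullet> u" if "z \<in> A1" for z
    using that by (auto simp: A1_def R_def)
  have A2: "pivot J p q (z - j0) \<bullet> u + J \<bullet> u \<le> (z - j0) \<bullet> u" if "z \<in> A2" for z
  proof -
    from that obtain y where y: "z = y + j1" "pivot J p q y \<bullet> u \<le> y \<bullet> u"
      by (force simp: A2_def R_def add.commute)
    moreover have "pivot J p q (y + (j1 - j0)) = pivot J p q y"
      by (intro pivot_add_parallel) (simp add: hj det2_simps)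
    ultimately show ?thesis
      using xJ by (simp add: inner_simps algebra_simps)
  qed
  have B1: "pivot J p q (z - j0) \<bullet> u \<le> (z - j0) \<bullet> u"
    "(z - j0) \<bullet> u < pivot J p q (z - j0) \<bullet> u + J \<bullet> u" "det2 J p < det2 J (z - j0)" if "z \<in> B1" for z
  proof -
    from that obtain y where y: "z = p + y" "y \<in> Q" "det2 J j0 < det2 J y" "y \<bullet> u < j1 \<bullet> u"
      by (auto simp: B1_def U_def)
    then show "det2 J p < det2 J (z - j0)"
      by (simp add: det2_simps)
    then have "pivot J p q (z - j0) = p"
      by (intro pivot_above less') simp
    then show "pivot J p q (z - j0) \<bullet> u \<le> (z - j0) \<bullet> u"
      "(z - j0) \<bullet> u < pivot J p q (z - j0) \<bullet> u + J \<bullet> u"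
      using y strip[of y] xJ by (auto simp: inner_simps)
  qed
  have B2: "pivot J p q (z - j0) \<bullet> u \<le> (z - j0) \<bullet> u"
    "(z - j0) \<bullet> u < pivot J p q (z - j0) \<bullet> u + J \<bullet> u" "det2 J (z - j0) < det2 J q" if "z \<in> B2" for z
  proof -
    from that obtain y where y: "z = q + y" "y \<in> Q" "det2 J y < det2 J j0" "y \<bullet> u < j1 \<bullet> u"
      by (auto simp: B2_def D_def)
    then show "det2 J (z - j0) < det2 J q"
      by (simp add: det2_simps)
    then have "pivot J p q (z - j0) = q"
      by (intro pivot_below less') simp
    then show "pivot J p q (z - j0) \<bullet> u \<le> (z - j0) \<bullet> u"
      "(z - j0) \<bullet> u < pivot J p q (z - j0) \<bullet> u + J \<bullet> u"
      using y strip[of y] xJ by (auto simp: inner_simps)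
  qed
  have B3: "pivot J p q (z - j0) \<bullet> u \<le> (z - j0) \<bullet> u"
    "(z - j0) \<bullet> u < pivot J p q (z - j0) \<bullet> u + J \<bullet> u"
    "det2 J (z - j0) \<le> det2 J p" "det2 J q \<le> det2 J (z - j0)" if "z \<in> B3" for z
  proof -
    from that obtain t s where ts: "0 < t" "t < 1" "0 < s" "s < 1"
      and z: "z - j0 = q + t *\<^sub>R (p - q) + s *\<^sub>R J"
      by (auto simp: B3_def f_def mem_box_cart forall_2 algebra_simps)
    have "pivot J p q (z - j0) = q + t *\<^sub>R (p - q)"
      unfolding z using ts by (intro pivot_between less') (auto simp: det2_simps)
    then show "pivot J p q (z - j0) \<bullet> u \<le> (z - j0) \<bullet> u"
      "(z - j0) \<bullet> u < pivot J p q (z - j0) \<bullet> u + J \<bullet> u"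
      using ts xJ by (auto simp: z inner_simps)
    have "0 \<le> t * (det2 J p - det2 J q)" "0 \<le> (1 - t) * (det2 J p - det2 J q)"
      using ts less' by auto
    then show "det2 J (z - j0) \<le> det2 J p" "det2 J q \<le> det2 J (z - j0)"
      by (auto simp: z det2_simps algebra_simps)
  qed
  have "measure lebesgue (P \<inter> R) + measure lebesgue (P - R) = measure lebesgue P"
    using measure_lebesgue_Un_disjoint[OF PR] by (simp add: Int_Diff_Un Int_Diff_disjoint)
  then have mA: "measure lebesgue A1 + measure lebesgue A2 = measure lebesgue P"
    by (simp add: A1_def A2_def measure_translation)
  have "measure lebesgue ((Q \<inter> U) \<union> (Q \<inter> D)) = measure lebesgue Q"
  proof (rule measure_negligible_symdiff)
    have "u \<noteq> 0" using width by auto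
    have "negligible ({z. u \<bullet> z = j1 \<bullet> u} \<union> {z. det2 J z = det2 J j0})"
      using \<open>u \<noteq> 0\<close> \<open>J \<noteq> 0\<close> by (intro negligible_Un negligible_hyperplane negligible_det2_line) auto
    moreover have "Q - (Q \<inter> U \<union> Q \<inter> D) \<union> (Q \<inter> U \<union> Q \<inter> D - Q)
       \<subseteq> {z. u \<bullet> z = j1 \<bullet> u} \<union> {z. det2 J z = det2 J j0}"
      using strip by (force simp: U_def D_def inner_commute)
    ultimately show "negligible (Q - (Q \<inter> U \<union> Q \<inter> D) \<union> (Q \<inter> U \<union> Q \<inter> D - Q))"
      by (rule negligible_subset)
  qed (use lmeasurable_compact[OF Q] in auto)
  moreover have "(Q \<inter> U) \<inter> (Q \<inter> D) = {}"
    by (auto simp: U_def D_def)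
  ultimately have mB: "measure lebesgue B1 + measure lebesgue B2 = measure lebesgue Q"
    using measure_lebesgue_Un_disjoint[OF QU] by (simp add: B1_def B2_def measure_translation)
  have "measure lebesgue B3 = \<bar>det2 (p - q) J\<bar>"
    unfolding B3_def f_def by (simp add: measure_translation parallelogram_image)
  also have "\<dots> = det2 J (p - q)"
    using less' by (subst det2_swap) (simp add: det2_simps)
  finally have mC: "measure lebesgue B3 = det2 J (p - q)" .

  have "measure lebesgue (A1 \<union> (A2 \<union> (B1 \<union> (B2 \<union> B3))))
      = measure lebesgue A1 + (measure lebesgue A2 + (measure lebesgue B1 + (measure lebesgue B2 + measure lebesgue B3)))"
  proof -
    have "B2 \<inter> B3 = {}" "B1 \<inter> (B2 \<union> B3) = {}"
      using B1(3) B2(3) B3(3,4) less' by fastforce+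
    moreover have "A2 \<inter> (B1 \<union> (B2 \<union> B3)) = {}"
      using A2 B1(2) B2(2) B3(2) by (fastforce simp: not_le[symmetric])
    moreover have "A1 \<inter> (A2 \<union> (B1 \<union> (B2 \<union> B3))) = {}"
      using A1 A2 B1(1) B2(1) B3(1) xJ(2) by (fastforce simp: not_le[symmetric])
    ultimately show ?thesis
      by (simp add: meas measure_lebesgue_Un_disjoint fmeasurable.Un)
  qed
  also have "\<dots> = measure lebesgue P + measure lebesgue Q + det2 J (p - q)"
    using mA mB mC by simp
  finally have *: "measure lebesgue (A1 \<union> (A2 \<union> (B1 \<union> (B2 \<union> B3)))) = \<dots>" .
  have "A1 \<subseteq> P + Q" "A2 \<subseteq> P + Q" "B1 \<subseteq> P + Q" "B2 \<subseteq> P + Q"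
    using j pq unfolding A1_def A2_def B1_def B2_def by (auto simp: set_plus_def) (metis add.commute)+
  moreover have "B3 \<subseteq> P + Q"
  proof
    fix z assume "z \<in> B3"
    then obtain t s where ts: "0 < t" "t < 1" "0 < s" "s < 1"
      and z: "z = ((1 - t) *\<^sub>R q + t *\<^sub>R p) + ((1 - s) *\<^sub>R j0 + s *\<^sub>R j1)"
      by (auto simp: B3_def f_def mem_box_cart forall_2 algebra_simps J_def)
    show "z \<in> P + Q"
      unfolding z using ts pq j P Qconv by (intro set_plus_intro convexD) auto
  qed
  ultimately have "A1 \<union> (A2 \<union> (B1 \<union> (B2 \<union> B3))) \<subseteq> P + Q"
    by simp
  moreover have "P + Q \<in> lmeasurable"
    using P Q by (intro lmeasurable_compact compact_set_plus)
  ultimately have "measure lebesgue (A1 \<union> (A2 \<union> (B1 \<union> (B2 \<union> B3)))) \<le> measure lebesgue (P + Q)"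
    using meas by (intro measure_mono_fmeasurable) (auto intro!: sets.Un)
  with * show ?thesis
    by (simp add: J_def)
qed

lemma in_segment_0: "z \<in> closed_segment 0 j \<longleftrightarrow> (\<exists>s. 0 \<le> s \<and> s \<le> 1 \<and> z = s *\<^sub>R j)"
  by (auto simp: in_segment)

lemma convex_parallel_between:
  assumes "convex P" "y \<in> P" "y + r *\<^sub>R j \<in> P" "0 \<le> c \<and> c \<le> r \<or> r \<le> c \<and> c \<le> 0"
  shows "y + c *\<^sub>R j \<in> P"
proof (cases "r = 0")
  case False
  then have "0 \<le> c / r" "c / r \<le> 1"
    using assms(4) by (auto simp: zero_le_divide_iff divide_le_eq_1)
  then have "(1 - c / r) *\<^sub>R y + (c / r) *\<^sub>R (y + r *\<^sub>R j) \<in> P"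
    using assms by (intro convexD) auto
  moreover have "(1 - c / r) *\<^sub>R y + (c / r) *\<^sub>R (y + r *\<^sub>R j) = y + c *\<^sub>R j"
    using False by (simp add: algebra_simps)
  ultimately show ?thesis by simp
qed (use assms in auto)

lemma measure_plus_segment_le:
  fixes P :: "(real^2) set"
  assumes P: "compact P" "convex P" and "j \<noteq> 0" and pq: "p \<in> P" "q \<in> P"
    and ext: "\<And>z. z \<in> P \<Longrightarrow> det2 j q \<le> det2 j z \<and> det2 j z \<le> det2 j p"
  shows "measure lebesgue (P + closed_segment 0 j) \<le> measure lebesgue P + det2 j (p - q)"
proof (cases "det2 j p = det2 j q")
  case True
  have "P + closed_segment 0 j \<subseteq> {z. det2 j z = det2 j p}"
    using ext True by (force simp: set_plus_def in_segment_0 det2_simps)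
  then have "negligible (P + closed_segment 0 j)"
    using negligible_det2_line[OF \<open>j \<noteq> 0\<close>] negligible_subset by blast
  then show ?thesis
    using True by (simp add: negligible_imp_measure0 det2_simps)
next
  case False
  then have less: "det2 j q < det2 j p"
    using ext[OF pq(1)] by simp
  have "0 < j \<bullet> j" using \<open>j \<noteq> 0\<close> by simp
  define f where "f = (\<lambda>v :: real^2. (v $ 1) *\<^sub>R (p - q) + (v $ 2) *\<^sub>R j)"
  define R where "R = {z. z \<bullet> j < pivot j p q z \<bullet> j}"
  define A2 where "A2 = (+) j ` (P - R)"
  define B where "B = (+) q ` f ` cbox 0 1"
  have "open R" unfolding R_def by (rule open_left_of_pivot)
  then have PR: "P \<inter> R \<in> lmeasurable" "P - R \<in> lmeasurable"
    using lmeasurable_compact_Int_Diff_open[OF P(1)] by auto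
  have meas: "A2 \<in> lmeasurable" "B \<in> lmeasurable"
    unfolding A2_def B_def f_def
    using PR parallelogram_image(3) by (auto intro: measurable_translation)
  have "measure lebesgue (P \<inter> R) + measure lebesgue (P - R) = measure lebesgue P"
    using measure_lebesgue_Un_disjoint[OF PR] by (simp add: Int_Diff_Un Int_Diff_disjoint)
  then have mA: "measure lebesgue (P \<inter> R) + measure lebesgue A2 = measure lebesgue P"
    by (simp add: A2_def measure_translation)
  have "measure lebesgue B = \<bar>det2 (p - q) j\<bar>"
    unfolding B_def f_def by (simp add: measure_translation parallelogram_image)
  also have "\<dots> = det2 j (p - q)"
    using less by (subst det2_swap) (simp add: det2_simps)
  finally have mB: "measure lebesgue B = det2 j (p - q)" .
  have "P + closed_segment 0 j \<subseteq> (P \<inter> R) \<union> A2 \<union> B"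
  proof
    fix z assume "z \<in> P + closed_segment 0 j"
    then obtain y s where y: "y \<in> P" and s: "0 \<le> s" "s \<le> 1" and z: "z = y + s *\<^sub>R j"
      by (auto simp: set_plus_def in_segment_0)
    define k where "k = pivot j p q z"
    have piv: "pivot j p q (y + c *\<^sub>R j) = k" for c
      unfolding k_def z by (simp add: pivot_add_parallel det2_simps)
    have "det2 j k = det2 j y"
      using piv[of 0] det2_pivot[OF less, of y] ext[OF y] by simp
    then obtain r where "k - y = r *\<^sub>R j"
      using det2_eq_0_imp_parallel[of j "k - y"] \<open>j \<noteq> 0\<close> by (auto simp: det2_simps)
    then have k: "k = y + r *\<^sub>R j" by (simp add: algebra_simps)
    then have "y + r *\<^sub>R j \<in> P"
      using pivot_in[OF P(2) pq, of j z] by (simp add: k_def)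
    note between = convex_parallel_between[OF P(2) y this]
    consider "s < r" | "r \<le> s - 1" | "r \<le> s" "s \<le> r + 1" by linarith
    then show "z \<in> (P \<inter> R) \<union> A2 \<union> B"
    proof cases
      case 1
      then have "z \<in> P" using between[of s] s by (simp add: z)
      moreover have "z \<in> R"
        using 1 \<open>0 < j \<bullet> j\<close> by (simp add: R_def z piv) (simp add: k inner_simps)
      ultimately show ?thesis by simp
    next
      case 2
      then have "y + (s - 1) *\<^sub>R j \<in> P" using between[of "s - 1"] s by simp
      moreover have "y + (s - 1) *\<^sub>R j \<notin> R"
        using 2 \<open>0 < j \<bullet> j\<close> by (simp add: R_def piv) (simp add: k inner_simps mult_le_cancel_right)
      moreover have "z = j + (y + (s - 1) *\<^sub>R j)" by (simp add: z algebra_simps)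
      ultimately show ?thesis unfolding A2_def by blast
    next
      case 3
      obtain t where t: "0 \<le> t" "t \<le> 1" "k = q + t *\<^sub>R (p - q)"
        unfolding k_def by (rule pivot_on_segment)
      have "z = k + (s - r) *\<^sub>R j"
        by (simp add: z k algebra_simps)
      then have "z = q + f (vector [t, s - r])"
        by (simp add: t f_def)
      moreover have "vector [t, s - r] \<in> cbox (0 :: real^2) 1"
        using t 3 by (simp add: mem_box_cart forall_2)
      ultimately show ?thesis unfolding B_def by blast
    qed
  qed
  then have "measure lebesgue (P + closed_segment 0 j) \<le> measure lebesgue ((P \<inter> R) \<union> A2 \<union> B)"
    using PR meas P fmeasurable.Un[OF fmeasurable.Un[OF PR(1) meas(1)] meas(2)]
    by (intro measure_mono_fmeasurable fmeasurableD[OF lmeasurable_compact] compact_set_plus) simp_all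
  also have "\<dots> \<le> measure lebesgue ((P \<inter> R) \<union> A2) + measure lebesgue B"
    using PR meas by (intro measure_Un_le) (auto intro!: fmeasurableD)
  also have "\<dots> \<le> measure lebesgue (P \<inter> R) + measure lebesgue A2 + measure lebesgue B"
    using PR meas by (intro add_right_mono measure_Un_le) (auto intro!: fmeasurableD)
  finally show ?thesis using mA mB by simp
qed

lemma measure_plus_segment:
  fixes P :: "(real^2) set"
  assumes P: "compact P" "convex P" and "v \<noteq> 0" "0 \<le> b" and pq: "p \<in> P" "q \<in> P"
    and ext: "\<And>z. z \<in> P \<Longrightarrow> det2 v q \<le> det2 v z \<and> det2 v z \<le> det2 v p"
  shows "measure lebesgue (P + closed_segment 0 (b *\<^sub>R v)) = measure lebesgue P + b * det2 v (p - q)"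
proof (cases "b = 0")
  case True
  then have "P + closed_segment 0 (b *\<^sub>R v) = P"
    by (auto simp: set_plus_def)
  then show ?thesis using True by simp
next
  case False
  define j where "j = b *\<^sub>R v"
  have b: "0 < b" and j: "j \<noteq> 0"
    using False assms by (auto simp: j_def)
  have det_j: "det2 j z = b * det2 v z" for z
    by (simp add: j_def det2_simps)
  have "measure lebesgue (P + closed_segment 0 j) \<le> measure lebesgue P + det2 j (p - q)"
    by (rule measure_plus_segment_le) (use P j pq ext b in \<open>auto simp: det_j\<close>)
  moreover have "measure lebesgue P + det2 j (p - q) \<le> measure lebesgue (P + closed_segment 0 j)"
  proof (cases "det2 v p = det2 v q")
    case True
    have "P \<subseteq> P + closed_segment 0 j"
      using set_zero_plus2[of "closed_segment 0 j" P] by (simp add: add.commute)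
    then have "measure lebesgue P \<le> measure lebesgue (P + closed_segment 0 j)"
      using P by (intro measure_mono_fmeasurable)
        (auto intro!: fmeasurableD lmeasurable_compact compact_set_plus)
    then show ?thesis using True by (simp add: det_j det2_simps)
  next
    case False
    then have "det2 (j - 0) q < det2 (j - 0) p"
      using ext[OF pq(1)] b by (simp add: det_j)
    moreover have "0 \<bullet> j \<le> z \<bullet> j \<and> z \<bullet> j \<le> j \<bullet> j" if "z \<in> closed_segment 0 j" for z
      using that by (auto simp: in_segment_0 mult_left_le_one_le)
    moreover have "measure lebesgue (closed_segment 0 j) = 0"
    proof (rule negligible_imp_measure0, rule negligible_subset[OF negligible_det2_line[OF j, of 0]])
      show "closed_segment 0 j \<subseteq> {z. det2 j z = 0}"
        by (auto simp: in_segment_0 det2_simps)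
    qed
    ultimately show ?thesis
      using measure_plus_lower_bound[of P "closed_segment 0 j" 0 j p q j] P pq j by simp
  qed
  ultimately show ?thesis by (simp add: j_def[symmetric] det_j)
qed

text \<open>Here \<open>\<sigma>\<close> is a sign that lets the lemma be used with either polytope on the positive side.\<close>

lemma plus_segment_absorb:
  fixes P :: "(real^2) set"
  assumes "convex P" "0 \<in> P" "a *\<^sub>R v \<in> P" "y \<in> P"
    and a: "0 \<le> a" and b: "0 \<le> b" and u: "0 < v \<bullet> u"
    and y: "0 \<le> y \<bullet> u" and w: "0 \<le> w \<bullet> u" "w \<bullet> u \<le> b * (v \<bullet> u)"
    and y2: "y \<bullet> u \<le> a * (v \<bullet> u)"
    and sigma: "0 \<le> - (\<sigma> * det2 v w)" "- (\<sigma> * det2 v w) \<le> \<sigma> * det2 v y" "\<sigma> \<noteq> 0"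
  shows "y + w \<in> P + closed_segment 0 (b *\<^sub>R v)"
proof -
  obtain t where t: "0 \<le> t" "t \<le> 1" "t * det2 v y = - det2 v w"
  proof -
    define A B where "A = \<sigma> * det2 v y" and "B = - (\<sigma> * det2 v w)"
    have AB: "0 \<le> B" "B \<le> A"
      using sigma by (auto simp: A_def B_def)
    then have "B / A * A = B"
      by auto
    then have "\<sigma> * (B / A * det2 v y) = \<sigma> * - det2 v w"
      unfolding A_def B_def by (simp only: mult_ac)
    then have "B / A * det2 v y = - det2 v w"
      by (rule iffD1[OF mult_left_cancel[OF \<open>\<sigma> \<noteq> 0\<close>]])
    moreover have "0 \<le> B / A" "B / A \<le> 1"
      using AB by (auto simp: divide_le_eq_1)
    ultimately show ?thesis using that by blast
  qed
  have "det2 v (t *\<^sub>R y + w) = 0" using t(3) by (simp add: det2_simps)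
  moreover have "v \<noteq> 0" using u by auto
  ultimately obtain s where s: "t *\<^sub>R y + w = s *\<^sub>R v"
    by (rule det2_eq_0_imp_parallel)
  have "s * (v \<bullet> u) = t * (y \<bullet> u) + w \<bullet> u"
    using arg_cong[OF s, of "\<lambda>z. z \<bullet> u"] by (simp add: inner_simps)
  moreover have "t * (y \<bullet> u) \<le> t * (a * (v \<bullet> u))"
    using y2 t by (intro mult_left_mono)
  ultimately have "0 \<le> s * (v \<bullet> u)" "s * (v \<bullet> u) \<le> (t * a + b) * (v \<bullet> u)"
    using t y w by (auto simp: algebra_simps)
  then have s_bounds: "0 \<le> s" "s \<le> t * a + b"
    using u by (auto simp: zero_le_mult_iff)
  define c where "c = min s (t * a)"
  have c: "0 \<le> c" "c \<le> t * a" "0 \<le> s - c" "s - c \<le> b"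
    using s_bounds t a b by (auto simp: c_def min_def)
  have "(1 - t) *\<^sub>R y + t *\<^sub>R 0 \<in> P" "(1 - t) *\<^sub>R y + t *\<^sub>R (a *\<^sub>R v) \<in> P"
    using convexD[OF assms(1,4,2) _ t(1), of "1 - t"] convexD[OF assms(1,4,3) _ t(1), of "1 - t"] t(2)
    by (simp_all only: diff_ge_0_iff_ge diff_add_cancel)
  then have ends: "(1 - t) *\<^sub>R y \<in> P" "(1 - t) *\<^sub>R y + (t * a) *\<^sub>R v \<in> P"
    by simp_all
  have "(1 - t) *\<^sub>R y + c *\<^sub>R v \<in> P"
    by (rule convex_parallel_between[OF assms(1) ends]) (use c(1,2) in blast)
  moreover have "(s - c) *\<^sub>R v \<in> closed_segment 0 (b *\<^sub>R v)"
    using c b by (cases "b = 0") (auto simp: in_segment_0 intro!: exI[of _ "(s - c) / b"])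
  moreover have "y + w = ((1 - t) *\<^sub>R y + c *\<^sub>R v) + (s - c) *\<^sub>R v"
    using s by (simp add: algebra_simps)
  ultimately show ?thesis by (metis set_plus_intro)
qed

lemma measure_plus_opposite_sides:
  fixes P Q :: "(real^2) set"
  assumes P: "compact P" "convex P" "0 \<in> P" "a *\<^sub>R v \<in> P" "p \<in> P"
    and Q: "compact Q" "convex Q" "0 \<in> Q" "b *\<^sub>R v \<in> Q" "q \<in> Q"
    and ab: "0 \<le> a" "0 \<le> b" and u: "0 < v \<bullet> u"
    and stripP: "\<And>z. z \<in> P \<Longrightarrow> 0 \<le> z \<bullet> u \<and> z \<bullet> u \<le> a * (v \<bullet> u)"
    and stripQ: "\<And>z. z \<in> Q \<Longrightarrow> 0 \<le> z \<bullet> u \<and> z \<bullet> u \<le> b * (v \<bullet> u)"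
    and above: "\<And>z. z \<in> P \<Longrightarrow> 0 \<le> det2 v z \<and> det2 v z \<le> det2 v p"
    and below: "\<And>z. z \<in> Q \<Longrightarrow> det2 v q \<le> det2 v z \<and> det2 v z \<le> 0"
  shows "measure lebesgue (P + Q) = measure lebesgue P + measure lebesgue Q + b * det2 v p - a * det2 v q"
proof -
  define I where "I = closed_segment 0 (a *\<^sub>R v)"
  define J where "J = closed_segment 0 (b *\<^sub>R v)"
  have "v \<noteq> 0" using u by auto
  have "I \<subseteq> P" "J \<subseteq> Q"
    using P Q by (auto simp: I_def J_def closed_segment_subset)
  have "P + Q = (P + J) \<union> (Q + I)"
  proof (intro antisym subsetI)
    fix z assume "z \<in> P + Q"
    then obtain y w where yw: "y \<in> P" "w \<in> Q" "z = y + w" by (auto simp: set_plus_def)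
    consider "- det2 v w \<le> det2 v y" | "det2 v y \<le> - det2 v w" by linarith
    then show "z \<in> (P + J) \<union> (Q + I)"
    proof cases
      case 1
      have "y + w \<in> P + J"
        unfolding J_def by (rule plus_segment_absorb[where \<sigma> = 1 and a = a and u = u])
          (use yw P ab u 1 stripP[OF yw(1)] stripQ[OF yw(2)] above[OF yw(1)] below[OF yw(2)] in auto)
      then show ?thesis using yw by simp
    next
      case 2
      have "w + y \<in> Q + I"
        unfolding I_def by (rule plus_segment_absorb[where \<sigma> = "-1" and a = b and u = u])
          (use yw Q ab u 2 stripP[OF yw(1)] stripQ[OF yw(2)] above[OF yw(1)] below[OF yw(2)] in auto)
      then show ?thesis using yw by (simp add: add.commute)
    qed
  next
    fix z assume "z \<in> (P + J) \<union> (Q + I)"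
    moreover have "P + J \<subseteq> P + Q" "Q + I \<subseteq> Q + P"
      using \<open>I \<subseteq> P\<close> \<open>J \<subseteq> Q\<close> by (simp_all add: set_plus_mono2)
    ultimately show "z \<in> P + Q" by (auto simp: add.commute)
  qed
  moreover have "(P + J) \<inter> (Q + I) \<subseteq> {z. det2 v z = 0}"
  proof -
    have "0 \<le> det2 v z" if "z \<in> P + J" for z
      using that above by (auto simp: set_plus_def J_def in_segment_0 det2_simps)
    moreover have "det2 v z \<le> 0" if "z \<in> Q + I" for z
      using that below by (auto simp: set_plus_def I_def in_segment_0 det2_simps)
    ultimately show ?thesis by force
  qed
  then have "measure lebesgue ((P + J) \<inter> (Q + I)) = 0"
    using negligible_det2_line[OF \<open>v \<noteq> 0\<close>] negligible_subset negligible_imp_measure0 by blast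
  moreover have "P + J \<in> lmeasurable" "Q + I \<in> lmeasurable"
    using P Q by (auto intro!: lmeasurable_compact compact_set_plus simp: I_def J_def)
  ultimately have "measure lebesgue (P + Q) = measure lebesgue (P + J) + measure lebesgue (Q + I)"
    by (simp add: measure_Un3)
  also have "measure lebesgue (P + J) = measure lebesgue P + b * det2 v (p - 0)"
    unfolding J_def using P \<open>v \<noteq> 0\<close> ab above by (intro measure_plus_segment) (auto simp: det2_simps)
  also have "measure lebesgue (Q + I) = measure lebesgue Q + a * det2 v (0 - q)"
    unfolding I_def using Q \<open>v \<noteq> 0\<close> ab below by (intro measure_plus_segment) (auto simp: det2_simps)
  finally show ?thesis by (simp add: det2_simps)
qed

subsection \<open>Lattice polytopes\<close>

lemma lattice_polytopeD:
  assumes "lattice_polytope P"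
  shows "compact P" "convex P"
  using assms by (auto simp: lattice_polytope_def finite_imp_compact_convex_hull)

lemma lattice_polytope_hull:
  "finite V \<Longrightarrow> V \<noteq> {} \<Longrightarrow> V \<subseteq> integer_lattice \<Longrightarrow> lattice_polytope (convex hull V)"
  by (auto simp: lattice_polytope_def)

lemma convex_hull_inner_bounds:
  assumes "\<And>x. x \<in> V \<Longrightarrow> l \<le> c \<bullet> x \<and> c \<bullet> x \<le> k" "z \<in> convex hull V"
  shows "l \<le> c \<bullet> z \<and> c \<bullet> z \<le> k"
proof -
  have "convex hull V \<subseteq> {x. c \<bullet> x \<ge> l} \<inter> {x. c \<bullet> x \<le> k}"
    using assms(1)
    by (intro hull_minimal convex_Int convex_halfspace_ge convex_halfspace_le) auto
  then show ?thesis using assms(2) by auto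
qed

lemma lattice_polytope_maximum:
  assumes "lattice_polytope P"
  obtains p where "p \<in> P" "p \<in> integer_lattice" "\<And>z. z \<in> P \<Longrightarrow> c \<bullet> z \<le> c \<bullet> p"
proof -
  obtain V where V: "finite V" "V \<noteq> {}" "V \<subseteq> integer_lattice" "P = convex hull V"
    using assms by (auto simp: lattice_polytope_def)
  define p where "p = arg_max_on ((\<bullet>) c) V"
  have "p \<in> V" "\<And>z. z \<in> V \<Longrightarrow> c \<bullet> z \<le> c \<bullet> p"
  proof -
    obtain q where q: "q \<in> V" "c \<bullet> q = Max ((\<bullet>) c ` V)"
      using Max_in[of "(\<bullet>) c ` V"] V by fastforce
    then have "is_arg_max ((\<bullet>) c) (\<lambda>x. x \<in> V) q"
      using V by (auto simp: is_arg_max_linorder)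
    then have "is_arg_max ((\<bullet>) c) (\<lambda>x. x \<in> V) p"
      unfolding p_def arg_max_on_def arg_max_def by (rule someI)
    then show "p \<in> V" "\<And>z. z \<in> V \<Longrightarrow> c \<bullet> z \<le> c \<bullet> p"
      by (auto simp: is_arg_max_linorder)
  qed
  moreover have "c \<bullet> z \<le> c \<bullet> p" if "z \<in> P" for z
  proof -
    have "convex hull V \<subseteq> {x. c \<bullet> x \<le> c \<bullet> p}"
      using calculation by (intro hull_minimal convex_halfspace_le) auto
    then show ?thesis using that V by auto
  qed
  ultimately show ?thesis
    using V by (intro that[of p]) (auto intro: hull_inc)
qed

lemma lattice_width_eq:
  assumes "p0 \<in> P" "p1 \<in> P" "\<And>z. z \<in> P \<Longrightarrow> p0 \<bullet> u \<le> z \<bullet> u \<and> z \<bullet> u \<le> p1 \<bullet> u"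
  shows "lattice_width u P = p1 \<bullet> u - p0 \<bullet> u"
proof -
  have "(SUP x\<in>P. x \<bullet> u) = p1 \<bullet> u" "(INF x\<in>P. x \<bullet> u) = p0 \<bullet> u"
    using assms by (auto intro!: cSup_eq_maximum cInf_eq_minimum)
  then show ?thesis by (simp add: lattice_width_def)
qed

lemma lattice_width_attained:
  assumes "lattice_polytope P"
  obtains p0 p1 where "p0 \<in> P" "p1 \<in> P" "p0 \<in> integer_lattice" "p1 \<in> integer_lattice"
    "\<And>z. z \<in> P \<Longrightarrow> p0 \<bullet> u \<le> z \<bullet> u \<and> z \<bullet> u \<le> p1 \<bullet> u" "lattice_width u P = p1 \<bullet> u - p0 \<bullet> u"
proof -
  obtain p1 where p1: "p1 \<in> P" "p1 \<in> integer_lattice" "\<And>z. z \<in> P \<Longrightarrow> u \<bullet> z \<le> u \<bullet> p1"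
    using lattice_polytope_maximum[OF assms] by metis
  obtain p0 where p0: "p0 \<in> P" "p0 \<in> integer_lattice" "\<And>z. z \<in> P \<Longrightarrow> - u \<bullet> z \<le> - u \<bullet> p0"
    using lattice_polytope_maximum[OF assms] by metis
  have "p0 \<bullet> u \<le> z \<bullet> u \<and> z \<bullet> u \<le> p1 \<bullet> u" if "z \<in> P" for z
    using p0(3)[OF that] p1(3)[OF that] by (simp add: inner_commute)
  then show ?thesis
    using p0 p1 lattice_width_eq by (intro that) auto
qed

lemma mixed_area_lebesgue:
  assumes "compact P" "compact Q"
  shows "mixed_area P Q = measure lebesgue (P + Q) - measure lebesgue P - measure lebesgue Q"
  using assms by (simp add: mixed_area_def Vol2_def borel_compact compact_set_plus field_simps)

lemma mixed_area_commute: "mixed_area P Q = mixed_area Q P"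
  by (simp add: mixed_area_def add.commute)

lemma diagram_section_commute: "diagram_section u w1 w2 = diagram_section u w2 w1"
  unfolding diagram_section_def discrete_diagram_def by (auto; metis mixed_area_commute)

lemma diagram_sectionI:
  assumes "lattice_polytope P" "lattice_polytope Q" "lattice_width u P = real w1"
    "lattice_width u Q = real w2" "mixed_area P Q = real v"
  shows "v \<in> diagram_section u w1 w2"
  using assms unfolding diagram_section_def discrete_diagram_def by force

lemma integer_lattice_ops:
  assumes "x \<in> integer_lattice" "y \<in> integer_lattice"
  shows "x - y \<in> integer_lattice" "x \<bullet> y \<in> \<int>" "det2 x y \<in> \<int>"
  using assms by (auto simp: integer_lattice_def inner_vec_def sum_2 det2_def)

lemma primitive_vector_basis:
  assumes "primitive_vector u"
  obtains e f where "u \<in> integer_lattice" "e \<in> integer_lattice" "f \<in> integer_lattice"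
    "e \<bullet> u = 1" "f \<bullet> u = 0" "det2 e f = 1"
proof -
  obtain a b :: int where "coprime a b" and u: "u = vector [of_int a, of_int b]"
    using assms by (auto simp: primitive_vector_def)
  then obtain r s where "r * a + s * b = 1"
    using bezout_int[of a b] by auto
  then have "of_int r * of_int a + of_int s * of_int b = (1 :: real)"
    by (metis of_int_1 of_int_add of_int_mult)
  then show ?thesis
    by (intro that[of "vector [of_int r, of_int s]" "vector [- of_int b, of_int a]"])
      (auto simp: u integer_lattice_def forall_2 inner_vec_def sum_2 det2_def)
qed

text \<open>With \<open>e \<bullet> u = 1\<close> this makes \<open>det2 j z\<close> an integer combination of the widths \<open>j \<bullet> u\<close> and \<open>z \<bullet> u\<close>.\<close>

lemma det2_expand: "(e \<bullet> u) * det2 j z = (j \<bullet> u) * det2 e z - (z \<bullet> u) * det2 e j"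
  by (simp add: det2_def inner_vec_def sum_2 algebra_simps)

lemma abs_det2_le_mixed_area:
  assumes P: "compact P" "convex P" and Q: "compact Q" "convex Q"
    and "j0 \<in> Q" "j1 \<in> Q" "p \<in> P" "q \<in> P" "j0 \<bullet> u < j1 \<bullet> u"
    and "\<And>z. z \<in> Q \<Longrightarrow> j0 \<bullet> u \<le> z \<bullet> u \<and> z \<bullet> u \<le> j1 \<bullet> u"
    and "det2 (j1 - j0) (p - q) \<noteq> 0"
  shows "\<bar>det2 (j1 - j0) (p - q)\<bar> \<le> mixed_area P Q"
proof (cases "det2 (j1 - j0) q < det2 (j1 - j0) p")
  case True
  then have "measure lebesgue P + measure lebesgue Q + det2 (j1 - j0) (p - q) \<le> measure lebesgue (P + Q)"
    by (intro measure_plus_lower_bound[where u = u]) (use assms in auto)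
  then show ?thesis
    using True by (simp add: mixed_area_lebesgue P Q det2_simps)
next
  case False
  then have "det2 (j1 - j0) p < det2 (j1 - j0) q"
    using assms(11) by (simp add: det2_simps)
  moreover then have "measure lebesgue P + measure lebesgue Q + det2 (j1 - j0) (q - p) \<le> measure lebesgue (P + Q)"
    by (intro measure_plus_lower_bound[where u = u]) (use assms in auto)
  ultimately show ?thesis
    by (simp add: mixed_area_lebesgue P Q det2_simps)
qed

lemma det2_constant_on_lattice_polytope:
  assumes P: "lattice_polytope P"
    and "\<And>p q. p \<in> P \<Longrightarrow> q \<in> P \<Longrightarrow> p \<in> integer_lattice \<Longrightarrow> q \<in> integer_lattice \<Longrightarrow> det2 j (p - q) = 0"
  obtains k where "\<And>z. z \<in> P \<Longrightarrow> det2 j z = k"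
proof -
  define c where "c = (vector [- (j $ 2), j $ 1] :: real^2)"
  have det_c: "det2 j z = c \<bullet> z" for z
    by (simp add: c_def det2_eq_inner)
  obtain p where p: "p \<in> P" "p \<in> integer_lattice" "\<And>z. z \<in> P \<Longrightarrow> c \<bullet> z \<le> c \<bullet> p"
    using lattice_polytope_maximum[OF P] by metis
  obtain q where q: "q \<in> P" "q \<in> integer_lattice" "\<And>z. z \<in> P \<Longrightarrow> - c \<bullet> z \<le> - c \<bullet> q"
    using lattice_polytope_maximum[OF P] by metis
  have "c \<bullet> p = c \<bullet> q"
    using assms(2)[OF p(1) q(1) p(2) q(2)] by (simp add: det_c inner_simps)
  then show ?thesis
    using p(3) q(3) by (intro that[of "c \<bullet> p"]) (force simp: det_c intro!: antisym)
qed

lemma of_nat_mult_of_int_small: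
  assumes "\<bar>real n * of_int k\<bar> < real n"
  shows "k = 0"
proof (rule ccontr)
  assume "k \<noteq> 0"
  then have "1 \<le> \<bar>of_int k :: real\<bar>" by linarith
  then have "real n * 1 \<le> real n * \<bar>of_int k\<bar>" by (intro mult_left_mono) auto
  then show False
    using assms by (simp add: abs_mult)
qed

lemma mixed_area_gap:
  fixes w1 w2 d :: nat
  assumes u: "primitive_vector u" and P: "lattice_polytope P" and Q: "lattice_polytope Q"
    and w: "lattice_width u P = real w1" "lattice_width u Q = real w2" "0 < w1" "0 < w2"
    and d: "d = gcd w1 w2" and pos: "0 < mixed_area P Q"
  shows "real (Min {d, w1 div d, w2 div d}) \<le> mixed_area P Q"
proof (rule ccontr)
  assume "\<not> ?thesis"
  moreover have "Min {d, w1 div d, w2 div d} \<le> x" if "x \<in> {d, w1 div d, w2 div d}" for x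
    using that by (intro Min_le) auto
  then have "real (Min {d, w1 div d, w2 div d}) \<le> real x" if "x \<in> {d, w1 div d, w2 div d}" for x
    using that by (simp only: of_nat_le_iff)
  ultimately have small: "mixed_area P Q < real x" if "x \<in> {d, w1 div d, w2 div d}" for x
    using that by (meson less_le_trans not_le)
  define n1 n2 where "n1 = w1 div d" and "n2 = w2 div d"
  have n: "w1 = n1 * d" "w2 = n2 * d" "0 < d" "coprime n1 n2"
    using w d by (auto simp: n1_def n2_def intro!: div_gcd_coprime)
  note PC = lattice_polytopeD[OF P] and QC = lattice_polytopeD[OF Q]
  obtain e where e: "e \<in> integer_lattice" "e \<bullet> u = 1" and uL: "u \<in> integer_lattice"
    using primitive_vector_basis[OF u] by metis
  obtain i0 i1 where i: "i0 \<in> P" "i1 \<in> P" "i0 \<in> integer_lattice" "i1 \<in> integer_lattice"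
    "\<And>z. z \<in> P \<Longrightarrow> i0 \<bullet> u \<le> z \<bullet> u \<and> z \<bullet> u \<le> i1 \<bullet> u" "real w1 = i1 \<bullet> u - i0 \<bullet> u"
    using lattice_width_attained[OF P, of u] w by metis
  obtain j0 j1 where j: "j0 \<in> Q" "j1 \<in> Q" "j0 \<in> integer_lattice" "j1 \<in> integer_lattice"
    "\<And>z. z \<in> Q \<Longrightarrow> j0 \<bullet> u \<le> z \<bullet> u \<and> z \<bullet> u \<le> j1 \<bullet> u" "real w2 = j1 \<bullet> u - j0 \<bullet> u"
    using lattice_width_attained[OF Q, of u] w by metis
  define I J where "I = i1 - i0" and "J = j1 - j0"
  have IJ: "I \<in> integer_lattice" "J \<in> integer_lattice" "I \<bullet> u = real w1" "J \<bullet> u = real w2"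
    using i j by (auto simp: I_def J_def integer_lattice_ops inner_simps)
  then have nz: "I \<noteq> 0" "J \<noteq> 0"
    using w by auto
  have J_le: "\<bar>det2 J (p - q)\<bar> \<le> mixed_area P Q" if "p \<in> P" "q \<in> P" for p q
  proof (cases "det2 J (p - q) = 0")
    case False
    then show ?thesis
      unfolding J_def by (intro abs_det2_le_mixed_area[where u = u]) (use PC QC i j w that in auto)
  qed (use pos in simp)
  have I_le: "\<bar>det2 I (p - q)\<bar> \<le> mixed_area P Q" if "p \<in> Q" "q \<in> Q" for p q
  proof (cases "det2 I (p - q) = 0")
    case False
    then show ?thesis
      unfolding I_def mixed_area_commute[of P Q]
      by (intro abs_det2_le_mixed_area[where u = u]) (use PC QC i j w that in auto)
  qed (use pos in simp)
  obtain k l where k: "det2 e I = of_int k" and l: "det2 e J = of_int l"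
    using integer_lattice_ops(3) e IJ by (metis Ints_cases)
  have expand: "det2 J z = real w2 * det2 e z - (z \<bullet> u) * of_int l"
    "det2 I z = real w1 * det2 e z - (z \<bullet> u) * of_int k" for z
    using det2_expand[of e u J z] det2_expand[of e u I z] e IJ k l by auto
  have eq: "det2 J I = real d * of_int (int n2 * k - int n1 * l)"
    unfolding expand IJ k n by (simp add: algebra_simps)
  have "\<bar>det2 J I\<bar> < real d"
    using J_le[OF i(2,1)] small[of d] by (simp add: I_def)
  then have "int n2 * k - int n1 * l = 0"
    unfolding eq by (rule of_nat_mult_of_int_small)
  then have parallel: "det2 J I = 0" and kl: "int n2 * k = int n1 * l"
    using eq by auto
  then have "int n2 dvd l" "int n1 dvd k"
    using n(4) by (metis coprime_int_iff coprime_commute coprime_dvd_mult_right_iff dvd_triv_left)+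
  then obtain k' l' where kl': "l = int n2 * l'" "k = int n1 * k'"
    by (auto elim!: dvdE)
  have J0: "det2 J (p - q) = 0"
    if "p \<in> P" "q \<in> P" and L: "p \<in> integer_lattice" "q \<in> integer_lattice" for p q
  proof -
    obtain m x where m: "det2 e (p - q) = of_int m" "(p - q) \<bullet> u = of_int x"
      using integer_lattice_ops e uL L by (metis Ints_cases)
    have eq: "det2 J (p - q) = real n2 * of_int (int d * m - x * l')"
      unfolding expand m by (simp add: kl' n algebra_simps)
    have "\<bar>det2 J (p - q)\<bar> < real n2"
      using J_le[OF that(1,2)] small[of n2] by (simp add: n2_def)
    then have "int d * m - x * l' = 0"
      unfolding eq by (rule of_nat_mult_of_int_small)
    then show ?thesis using eq by simp
  qed
  have I0: "det2 I (p - q) = 0"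
    if "p \<in> Q" "q \<in> Q" and L: "p \<in> integer_lattice" "q \<in> integer_lattice" for p q
  proof -
    obtain m x where m: "det2 e (p - q) = of_int m" "(p - q) \<bullet> u = of_int x"
      using integer_lattice_ops e uL L by (metis Ints_cases)
    have eq: "det2 I (p - q) = real n1 * of_int (int d * m - x * k')"
      unfolding expand m by (simp add: kl' n algebra_simps)
    have "\<bar>det2 I (p - q)\<bar> < real n1"
      using I_le[OF that(1,2)] small[of n1] by (simp add: n1_def)
    then have "int d * m - x * k' = 0"
      unfolding eq by (rule of_nat_mult_of_int_small)
    then show ?thesis using eq by simp
  qed
  obtain c1 where c1: "\<And>z. z \<in> P \<Longrightarrow> det2 J z = c1"
    using det2_constant_on_lattice_polytope[OF P J0] by blast
  obtain c2 where c2: "\<And>z. z \<in> Q \<Longrightarrow> det2 I z = c2"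
    using det2_constant_on_lattice_polytope[OF Q I0] by blast
  have "det2 I J = 0" using parallel det2_swap[of I J] by simp
  then obtain t where "J = t *\<^sub>R I"
    using nz(1) by (rule det2_eq_0_imp_parallel)
  then have "det2 J z = t * det2 I z" for z
    by (simp add: det2_simps)
  then have "P + Q \<subseteq> {z. det2 J z = c1 + t * c2}"
    using c1 c2 by (auto simp: set_plus_def det2_simps algebra_simps)
  then have "measure lebesgue (P + Q) = 0"
    using negligible_det2_line[OF nz(2)] negligible_subset negligible_imp_measure0 by blast
  then have "mixed_area P Q \<le> 0"
    using measure_nonneg[of lebesgue P] measure_nonneg[of lebesgue Q]
    by (simp add: mixed_area_lebesgue PC QC del: measure_nonneg)
  then show False using pos by simp
qed

lemma exists_lattice_height:
  fixes m w d :: int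
  assumes "0 < d" "d - 1 \<le> w"
  obtains x y where "0 \<le> x" "x \<le> w" "d * y - x = m"
proof (rule that[of "(- m) mod d" "- ((- m) div d)"])
  show "(- m) mod d \<le> w"
    using assms pos_mod_bound[of d "- m"] by linarith
  show "d * - (- m div d) - - m mod d = m"
    using mult_div_mod_eq[of d "- m"] unfolding mult_minus_right by linarith
qed (use assms in simp)

lemma integer_lattice_combination:
  assumes "e \<in> integer_lattice" "f \<in> integer_lattice"
  shows "of_int x *\<^sub>R e + of_int y *\<^sub>R f \<in> integer_lattice"
  using assms by (auto simp: integer_lattice_def)

lemma combination_in_diagram_section:
  fixes w1 w2 d m1 m2 :: nat
  assumes u: "primitive_vector u" and d: "d = gcd w1 w2" "0 < d" "int d - 1 \<le> w1" "int d - 1 \<le> w2"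
  shows "m1 * (w1 div d) + m2 * (w2 div d) \<in> diagram_section u w1 w2"
proof -
  define n1 n2 where "n1 = w1 div d" and "n2 = w2 div d"
  have n: "w1 = n1 * d" "w2 = n2 * d"
    by (simp_all add: n1_def n2_def d(1))
  obtain e f where ef: "e \<in> integer_lattice" "f \<in> integer_lattice"
    "e \<bullet> u = 1" "f \<bullet> u = 0" "det2 e f = 1"
    using primitive_vector_basis[OF u] by metis
  define lat where "lat x y = of_int x *\<^sub>R e + of_int y *\<^sub>R f" for x y :: int
  have lat_u: "lat x y \<bullet> u = of_int x" for x y
    by (simp add: lat_def ef inner_simps)
  have det_lat: "det2 (lat x y) (lat x' y') = of_int (x * y' - y * x')" for x y x' y'
    using ef det2_swap[of f e] by (simp add: lat_def det2_simps)
  have lat_L: "lat x y \<in> integer_lattice" for x y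
    unfolding lat_def using ef by (intro integer_lattice_combination)
  define v where "v = lat (int d) 1"
  obtain x1 y1 where p: "0 \<le> x1" "x1 \<le> int w1" "int d * y1 - x1 = int m2"
    using exists_lattice_height[of "int d" "int w1" "int m2"] d(2-4) by auto
  obtain x2 y2 where q: "0 \<le> x2" "x2 \<le> int w2" "int d * y2 - x2 = - int m1"
    using exists_lattice_height[of "int d" "int w2" "- int m1"] d(2-4) by auto
  define P where "P = convex hull {0, real n1 *\<^sub>R v, lat x1 y1}"
  define Q where "Q = convex hull {0, real n2 *\<^sub>R v, lat x2 y2}"
  have multiple_lat: "real k *\<^sub>R v = lat (int k * int d) (int k)" for k
    by (simp add: v_def lat_def algebra_simps)
  have zero_lat: "0 = lat 0 0" by (simp add: lat_def)
  have P_L: "lattice_polytope P" and Q_L: "lattice_polytope Q"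
    unfolding P_def Q_def multiple_lat by (subst zero_lat; intro lattice_polytope_hull; use lat_L in auto)+
  note PC = lattice_polytopeD[OF P_L] and QC = lattice_polytopeD[OF Q_L]
  have P_in: "0 \<in> P" "real n1 *\<^sub>R v \<in> P" "lat x1 y1 \<in> P"
    and Q_in: "0 \<in> Q" "real n2 *\<^sub>R v \<in> Q" "lat x2 y2 \<in> Q"
    by (auto simp: P_def Q_def intro: hull_inc)
  have heights: "det2 v (lat x1 y1) = real m2" "det2 v (lat x2 y2) = - real m1"
  proof -
    have det_v: "det2 v (lat x y) = of_int (int d * y - x)" for x y
      by (simp add: v_def det_lat)
    show "det2 v (lat x1 y1) = real m2" "det2 v (lat x2 y2) = - real m1"
      unfolding det_v p(3) q(3) by simp_all
  qed
  have v_u: "v \<bullet> u = real d" by (simp add: v_def lat_u)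
  have x_bounds: "0 \<le> real_of_int x1" "real_of_int x1 \<le> real n1 * real d"
    "0 \<le> real_of_int x2" "real_of_int x2 \<le> real n2 * real d"
    using p(1,2) q(1,2) n(1,2) by (simp_all only: of_int_0_le_iff of_nat_mult[symmetric])
  have stripP: "0 \<le> z \<bullet> u \<and> z \<bullet> u \<le> real n1 * (v \<bullet> u)" if "z \<in> P" for z
    unfolding inner_commute[of z u]
    by (rule convex_hull_inner_bounds[OF _ that[unfolded P_def]])
      (use x_bounds in \<open>auto simp: inner_commute[of u] v_u lat_u\<close>)
  have stripQ: "0 \<le> z \<bullet> u \<and> z \<bullet> u \<le> real n2 * (v \<bullet> u)" if "z \<in> Q" for z
    unfolding inner_commute[of z u]
    by (rule convex_hull_inner_bounds[OF _ that[unfolded Q_def]])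
      (use x_bounds in \<open>auto simp: inner_commute[of u] v_u lat_u\<close>)
  have above: "0 \<le> det2 v z \<and> det2 v z \<le> det2 v (lat x1 y1)" if "z \<in> P" for z
    unfolding det2_eq_inner
    by (rule convex_hull_inner_bounds[OF _ that[unfolded P_def]])
      (unfold det2_eq_inner[symmetric], auto simp: heights det2_simps)
  have below: "det2 v (lat x2 y2) \<le> det2 v z \<and> det2 v z \<le> 0" if "z \<in> Q" for z
    unfolding det2_eq_inner
    by (rule convex_hull_inner_bounds[OF _ that[unfolded Q_def]])
      (unfold det2_eq_inner[symmetric], auto simp: heights det2_simps)
  have "measure lebesgue (P + Q) = measure lebesgue P + measure lebesgue Q
      + real n2 * det2 v (lat x1 y1) - real n1 * det2 v (lat x2 y2)"
    by (rule measure_plus_opposite_sides[where u = u])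
      (use PC QC P_in Q_in stripP stripQ above below v_u d(2) in auto)
  then have "mixed_area P Q = real (m1 * n1 + m2 * n2)"
    by (simp add: mixed_area_lebesgue PC QC heights)
  moreover have "lattice_width u P = real w1"
    using lattice_width_eq[OF P_in(1,2), of u] stripP by (simp add: v_u n)
  moreover have "lattice_width u Q = real w2"
    using lattice_width_eq[OF Q_in(1,2), of u] stripQ by (simp add: v_u n)
  ultimately show ?thesis
    using P_L Q_L diagram_sectionI unfolding n1_def n2_def by blast
qed

lemma saturation_in_diagram_section:
  fixes w1 w2 v :: nat
  assumes u: "primitive_vector u" and w: "w2 \<le> w1" "0 < w2" and v: "w1 mod w2 \<le> v"
  shows "v \<in> diagram_section u w1 w2"
proof -
  define b where "b = w1 mod w2"
  obtain e f where ef: "e \<in> integer_lattice" "f \<in> integer_lattice"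
    "e \<bullet> u = 1" "f \<bullet> u = 0" "det2 e f = 1"
    using primitive_vector_basis[OF u] by metis
  define lat where "lat x y = of_int x *\<^sub>R e + of_int y *\<^sub>R f" for x y :: int
  have lat_u: "lat x y \<bullet> u = of_int x" for x y
    by (simp add: lat_def ef inner_simps)
  have det_lat: "det2 (lat x y) (lat x' y') = of_int (x * y' - y * x')" for x y x' y'
    using ef det2_swap[of f e] by (simp add: lat_def det2_simps)
  have lat_L: "lat x y \<in> integer_lattice" for x y
    unfolding lat_def using ef by (intro integer_lattice_combination)
  define j where "j = lat (int w2) 1"
  define q where "q = lat (int w1) (int (w1 div w2))"
  obtain x y where xy: "0 \<le> x" "x \<le> int w1" "int w2 * y - x = int v - int b"
    using exists_lattice_height[of "int w2" "int w1" "int v - int b"] w by auto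
  define P where "P = convex hull {0, q, lat x y}"
  define Q where "Q = closed_segment 0 j"
  have zero_lat: "0 = lat 0 0" by (simp add: lat_def)
  have P_L: "lattice_polytope P" and Q_L: "lattice_polytope Q"
    unfolding P_def Q_def q_def j_def segment_convex_hull
    by (subst zero_lat; intro lattice_polytope_hull; use lat_L in auto)+
  note PC = lattice_polytopeD[OF P_L] and QC = lattice_polytopeD[OF Q_L]
  have P_in: "0 \<in> P" "q \<in> P" "lat x y \<in> P"
    by (auto simp: P_def intro: hull_inc)
  have b_eq: "int w2 * int (w1 div w2) - int w1 = - int b"
    unfolding b_def by (metis add_diff_cancel_left' minus_diff_eq mult_div_mod_eq of_nat_add of_nat_mult)
  have heights: "det2 j (lat x y) = real v - real b" "det2 j q = - real b"
  proof -
    have det_j: "det2 j (lat x' y') = of_int (int w2 * y' - x')" for x' y'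
      by (simp add: j_def det_lat)
    show "det2 j (lat x y) = real v - real b" "det2 j q = - real b"
      unfolding q_def det_j xy(3) b_eq by simp_all
  qed
  have j_u: "j \<bullet> u = real w2" and q_u: "q \<bullet> u = real w1"
    by (simp_all add: j_def q_def lat_u)
  have "j \<noteq> 0" using j_u w by auto
  have ext: "det2 j q \<le> det2 j z \<and> det2 j z \<le> det2 j (lat x y)" if "z \<in> P" for z
    unfolding det2_eq_inner
    by (rule convex_hull_inner_bounds[OF _ that[unfolded P_def]])
      (unfold det2_eq_inner[symmetric], use v in \<open>auto simp: heights det2_simps b_def\<close>)
  have stripP: "0 \<bullet> u \<le> z \<bullet> u \<and> z \<bullet> u \<le> q \<bullet> u" if "z \<in> P" for z
    unfolding inner_commute[of z u]
    by (rule convex_hull_inner_bounds[OF _ that[unfolded P_def]])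
      (use xy in \<open>auto simp: inner_commute[of u] q_u lat_u\<close>)
  have stripQ: "0 \<bullet> u \<le> z \<bullet> u \<and> z \<bullet> u \<le> j \<bullet> u" if "z \<in> Q" for z
    using that by (auto simp: Q_def in_segment_0 j_u mult_left_le_one_le)
  have "Q \<subseteq> {z. det2 j z = 0}"
    by (auto simp: Q_def in_segment_0 det2_simps)
  then have "measure lebesgue Q = 0"
    using negligible_det2_line[OF \<open>j \<noteq> 0\<close>] negligible_subset negligible_imp_measure0 by blast
  moreover have "measure lebesgue (P + Q) = measure lebesgue P + det2 j (lat x y - q)"
    using measure_plus_segment[OF PC \<open>j \<noteq> 0\<close> _ P_in(3,2) ext, of 1] by (simp add: Q_def)
  ultimately have "mixed_area P Q = real v"
    by (simp add: mixed_area_lebesgue PC QC heights det2_simps)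
  moreover have "lattice_width u P = real w1"
    using lattice_width_eq[OF P_in(1,2) stripP] by (simp add: q_u)
  moreover have "lattice_width u Q = real w2"
    using lattice_width_eq[of 0 Q j, OF _ _ stripQ] by (simp add: j_u Q_def)
  ultimately show ?thesis
    using P_L Q_L diagram_sectionI by blast
qed

theorem theorem4p5:
  fixes u :: "real^2" and w1 w2 d \<alpha> \<beta> :: nat
  assumes "primitive_vector u"
    and "\<not> (w1 = 0 \<and> w2 = 0)"
    and "d = gcd w1 w2"
    and "\<alpha> = Min {d, w1 div d, w2 div d}"
    and "\<beta> = min (w1 mod w2) (w2 mod w1)"
  shows "{1..<\<alpha>} \<subseteq> UNIV - diagram_section u w1 w2 \<and>
    ((w1 = 0 \<or> w2 = 0 \<longrightarrow> d = 1) \<longrightarrow>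
       width_semigroup w1 w2 \<subseteq> diagram_section u w1 w2) \<and>
    ((w1 = 0 \<or> w2 = 0 \<longrightarrow> d = 1) \<longrightarrow>
       {\<beta>..} \<subseteq> diagram_section u w1 w2)"
proof (intro conjI impI)
  show "{1..<\<alpha>} \<subseteq> UNIV - diagram_section u w1 w2"
  proof
    fix v assume v: "v \<in> {1..<\<alpha>}"
    have "v \<notin> diagram_section u w1 w2"
    proof
      assume "v \<in> diagram_section u w1 w2"
      then obtain P Q where PQ: "lattice_polytope P" "lattice_polytope Q"
        "lattice_width u P = real w1" "lattice_width u Q = real w2" "mixed_area P Q = real v"
        by (auto simp: diagram_section_def discrete_diagram_def)
      have "0 < w1" "0 < w2"
        using v assms(4) by (auto intro!: gr0I)
      then have "real \<alpha> \<le> mixed_area P Q"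
        unfolding assms(4) using assms(1,3) PQ v by (intro mixed_area_gap) auto
      then show False using PQ v by simp
    qed
    then show "v \<in> UNIV - diagram_section u w1 w2" by simp
  qed
next
  assume deg: "w1 = 0 \<or> w2 = 0 \<longrightarrow> d = 1"
  have d: "0 < d" "int d - 1 \<le> int w1" "int d - 1 \<le> int w2"
  proof -
    show "0 < d" using assms(2,3) by auto
    have "d \<le> w1 \<or> w1 = 0" "d \<le> w2 \<or> w2 = 0"
      using assms(3) by auto
    then show "int d - 1 \<le> int w1" "int d - 1 \<le> int w2"
      using deg by auto
  qed
  show semigroup: "width_semigroup w1 w2 \<subseteq> diagram_section u w1 w2"
    using combination_in_diagram_section[OF assms(1,3) d] assms(3)
    by (auto simp: width_semigroup_def)
  show "{\<beta>..} \<subseteq> diagram_section u w1 w2"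
  proof
    fix v assume "v \<in> {\<beta>..}"
    then have v: "min (w1 mod w2) (w2 mod w1) \<le> v" using assms(5) by simp
    consider "w1 = 0 \<or> w2 = 0" | "0 < w2" "w2 \<le> w1" | "0 < w1" "w1 < w2" by linarith
    then show "v \<in> diagram_section u w1 w2"
    proof cases
      case 1
      then have "w1 = 0 \<and> w2 = 1 \<or> w1 = 1 \<and> w2 = 0"
        using deg assms(3) by auto
      then have "v \<in> width_semigroup w1 w2"
        by (auto simp: width_semigroup_def)
      then show ?thesis using semigroup by blast
    next
      case 2
      then have "w1 mod w2 \<le> v"
        using v mod_less_divisor[of w2 w1] by (cases "w1 = w2") (auto simp: min_def split: if_splits)
      then show ?thesis
        using 2 assms(1) by (intro saturation_in_diagram_section)
    next
      case 3
      then have "w2 mod w1 \<le> v"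
        using v mod_less_divisor[OF 3(1), of w2] by (auto simp: min_le_iff_disj)
      then have "v \<in> diagram_section u w2 w1"
        using 3 assms(1) by (intro saturation_in_diagram_section) auto
      then show ?thesis by (simp add: diagram_section_commute)
    qed
  qed
qed

end
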